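(* Let $x$ be a real number with $x \neq -1$ and $x \neq 0$, and let $(a_n)_{n\ge1}$ be defined by \[ a_1 = x, \qquad a_n = x \sum_{r=\lceil n/2\rceil}^{n-1} \binom{r}{n-r} a_r \quad (n \ge 2). \] Then $(a_n)$ grows super-exponentially: for every constant $C>0$, $\limsup_{n\to\infty} |a_n|/C^n = +\infty$.
   Context: The paper states the conclusion as "the sequence grows super-exponentially"; here this phrase is made precise as: $|a_n|$ is not bounded by any exponential sequence $C^n$. *)

theory Defs
  imports Complex_Main "HOL-Library.Extended_Real"
begin

end

theory Submission
  imports Defs "HOL-Complex_Analysis.Complex_Analysis"
begin

text \<open>
  If the \<open>a n\<close> were exponentially bounded, their generating function \<open>A\<close> (with \<open>a 0\<close> replaced by 0)
  would be holomorphic near 0, and the recurrence says \<open>A (z + z\<^sup>2) = c * A z - z\<close> with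
  \<open>c = (1 + x) / x \<noteq> 0\<close>. The point 0 is a parabolic fixed point of \<open>z \<mapsto> z + z\<^sup>2\<close>, and \<open>A\<close> extends
  both ways along the dynamics: forward orbits of the disc with diameter \<open>[-1, 0]\<close> converge to 0
  uniformly, so \<open>A\<close> extends to a neighbourhood of that closed disc; backward orbits under the
  principal inverse branch converge to 0 on the plane slit along \<open>(-\<infinity>, 0]\<close>, so \<open>A\<close> extends there.
  In the coordinate \<open>u = z + 1/2\<close> the map becomes \<open>u\<^sup>2 + 1/4\<close> and \<open>B u = A (u - 1/2)\<close>
  is now holomorphic off a ray \<open>(-\<infinity>, -R]\<close> with \<open>R > 1/2\<close>. The functional equation
  \<open>B (u\<^sup>2 + 1/4) = c * B u - u + 1/2\<close> makes the right-hand side even, and reflection in 0 makes \<open>B\<close>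
  entire. The same equation then forces the maximum of \<open>|B|\<close> on discs to grow sublinearly,
  so \<open>B' = 0\<close>, whereas differentiating the equation at 0 gives \<open>c * B' 0 = 1\<close>.
\<close>

section \<open>Forward orbits at the parabolic fixed point\<close>

text \<open>Both sides amount to |w|^2 <= Re w. It is applied to -u and to 1 + u, since u -> -1 - u
  maps the disc about -1/2 to itself.\<close>

lemma Re_inverse_ge_1_iff:
  fixes w :: complex
  assumes "w \<noteq> 0"
  shows "Re (1 / w) \<ge> 1 \<longleftrightarrow> norm (w - 1/2) \<le> 1/2"
proof -
  have pos: "(Re w)\<^sup>2 + (Im w)\<^sup>2 > 0"
    using assms by (simp add: complex_neq_0)
  have "norm (w - 1/2) \<le> 1/2 \<longleftrightarrow> (norm (w - 1/2))\<^sup>2 \<le> (1/2)\<^sup>2"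
    by (subst power_mono_iff) auto
  also have "\<dots> \<longleftrightarrow> (Re w)\<^sup>2 + (Im w)\<^sup>2 \<le> Re w"
    unfolding cmod_power2 by (simp add: power2_eq_square algebra_simps) linarith
  also have "\<dots> \<longleftrightarrow> Re (1 / w) \<ge> 1"
    using pos by (simp add: Re_divide field_simps)
  finally show ?thesis by simp
qed

text \<open>In the coordinate \<open>-1/z\<close> the map \<open>z \<mapsto> z + z\<^sup>2\<close> moves the half plane \<open>Re \<ge> 1\<close>,
  the image of the disc, to the right by at least 1.\<close>

lemma parabolic_orbit_bound:
  fixes z :: complex
  assumes "norm (z + 1/2) \<le> 1/2"
  shows "norm (((\<lambda>z. z + z\<^sup>2) ^^ n) z) \<le> 1 / (real n + 1)"
proof -
  define w where "w = (\<lambda>n. ((\<lambda>z. z + z\<^sup>2) ^^ n) z)"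
  have Suc_w: "w (Suc n) = w n + (w n)\<^sup>2" for n
    by (simp add: w_def)
  have neg_disc: "Re (- (1 / u)) \<ge> 1 \<longleftrightarrow> norm (u + 1/2) \<le> 1/2" if "u \<noteq> 0" for u :: complex
    using Re_inverse_ge_1_iff[of "-u"] that norm_minus_cancel[of "u + 1/2"] by simp
  \<comment> \<open>The first alternative covers orbits that land on 0, for instance through -1:
    there the coordinate -1/w is lost, as \<open>1 / 0 = 0\<close>.\<close>
  have inv: "w n = 0 \<or> Re (- (1 / w n)) \<ge> real n + 1" for n
  proof (induction n)
    case 0
    then show ?case
      using neg_disc[of z] assms by (auto simp: w_def)
  next
    case (Suc n)
    show ?case
    proof (cases "w n = 0 \<or> w n = -1")
      case True
      then show ?thesis by (auto simp: Suc_w)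
    next
      case False
      then have ge: "Re (- (1 / w n)) \<ge> real n + 1"
        using Suc by auto
      then have "norm (w n + 1/2) \<le> 1/2"
        using neg_disc[of "w n"] False by linarith
      moreover have nz: "1 + w n \<noteq> 0"
        using False by (metis add_eq_0_iff)
      ultimately have "Re (1 / (1 + w n)) \<ge> 1"
        using Re_inverse_ge_1_iff[of "1 + w n"] by (simp add: algebra_simps)
      \<comment> \<open>Partial fractions of 1/(w (1 + w)): one step gains Re (1/(1 + w)) >=
        1.\<close>
      moreover have "- (1 / w (Suc n)) = - (1 / w n) + 1 / (1 + w n)"
      proof -
        have "w (Suc n) = w n * (1 + w n)"
          by (simp add: Suc_w power2_eq_square algebra_simps)
        then show ?thesis
          using False nz by (simp add: divide_simps)
      qed
      ultimately show ?thesis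
        using ge by simp
    qed
  qed
  show ?thesis
  proof (cases "w n = 0")
    case False
    then have "real n + 1 \<le> norm (- (1 / w n))"
      using inv[of n] complex_Re_le_cmod[of "- (1 / w n)"] by linarith
    then show ?thesis
      using False by (simp add: w_def norm_divide field_simps)
  qed (simp add: w_def)
qed

section \<open>Extension to a neighbourhood of the closed disc\<close>

text \<open>Solved as A z = (A (z + z^2) + z) / c, the equation defines A at z once A is defined at
  z + z^2, so each use pulls the domain back once. Agreement with A is claimed only near 0, as the
  preimage need not be connected.\<close>

lemma pullback_extension:
  fixes A :: "complex \<Rightarrow> complex"
  assumes "A holomorphic_on ball 0 \<rho>" "c \<noteq> 0"
    and fe: "\<forall>\<^sub>F z in nhds 0. A (z + z\<^sup>2) = c * A z - z"
  shows "\<exists>B. B holomorphic_on {z. ((\<lambda>z. z + z\<^sup>2) ^^ k) z \<in> ball 0 \<rho>} \<and>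
             (\<forall>\<^sub>F z in nhds 0. B z = A z)"
proof (induction k)
  case 0
  show ?case
    using assms(1) by (intro exI[of _ A]) (simp add: ball_def)
next
  case (Suc k)
  then obtain B where B: "B holomorphic_on {z. ((\<lambda>z. z + z\<^sup>2) ^^ k) z \<in> ball 0 \<rho>}"
    and BA: "\<forall>\<^sub>F z in nhds 0. B z = A z" by blast
  define B' where "B' = (\<lambda>z. (B (z + z\<^sup>2) + z) / c)"
  have "(B \<circ> (\<lambda>z. z + z\<^sup>2)) holomorphic_on {z. ((\<lambda>z. z + z\<^sup>2) ^^ Suc k) z \<in> ball 0 \<rho>}"
    by (rule holomorphic_on_compose_gen[OF _ B])
       (auto intro!: holomorphic_intros simp: funpow_Suc_right simp del: funpow.simps)
  then have "B' holomorphic_on {z. ((\<lambda>z. z + z\<^sup>2) ^^ Suc k) z \<in> ball 0 \<rho>}"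
    unfolding B'_def o_def using \<open>c \<noteq> 0\<close> by (intro holomorphic_intros)
  moreover have "\<forall>\<^sub>F z in nhds 0. B' z = A z"
  proof -
    have "((\<lambda>z::complex. z + z\<^sup>2) \<longlongrightarrow> 0 + 0\<^sup>2) (nhds 0)"
      by (intro tendsto_intros filterlim_ident)
    then have "\<forall>\<^sub>F z in nhds 0. B (z + z\<^sup>2) = A (z + z\<^sup>2)"
      using eventually_compose_filterlim[OF BA] by simp
    then show ?thesis
      using fe by eventually_elim (use \<open>c \<noteq> 0\<close> in \<open>simp add: B'_def\<close>)
  qed
  ultimately show ?case by blast
qed

lemma less_if_square_less:
  fixes t R :: real
  assumes "t\<^sup>2 + 1/4 < R"
  shows "t < R"
proof -
  have "0 \<le> (t - 1/2)\<^sup>2" by simp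
  then show ?thesis
    using assms by (simp add: power2_eq_square algebra_simps)
qed

lemma norm_square_add_quarter_less:
  fixes u :: complex
  assumes "(norm u)\<^sup>2 + 1/4 < R"
  shows "norm (u\<^sup>2 + 1/4) < R"
  using norm_triangle_ineq[of "u\<^sup>2" "1/4"] assms by (simp add: norm_power norm_divide)

text \<open>For 1/(N + 1) < \<rho> the N-th iterate maps the closed disc into
  \<open>ball 0 \<rho>\<close>; its open preimage contains the disc and, by compactness, an
  e-neighbourhood of it. In u = z + 1/2 this is a disc of radius 1/2 + e. The condition |u|^2 + 1/4
  < R keeps both u and u^2 + 1/4 inside.\<close>

lemma disc_extension:
  fixes A :: "complex \<Rightarrow> complex"
  assumes "A holomorphic_on ball 0 \<rho>" "c \<noteq> 0" "\<rho> > 0"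
    and fe: "\<forall>\<^sub>F z in nhds 0. A (z + z\<^sup>2) = c * A z - z"
  obtains R B where "R > 1/2" "B holomorphic_on ball 0 R"
    "\<And>u. (norm u)\<^sup>2 + 1/4 < R \<Longrightarrow> B (u\<^sup>2 + 1/4) = c * B u - u + 1/2"
    "\<forall>\<^sub>F z in nhds 0. B (z + 1/2) = A z"
proof -
  obtain N :: nat where N: "1 / (real N + 1) < \<rho>"
    using reals_Archimedean[OF \<open>\<rho> > 0\<close>] by (auto simp: inverse_eq_divide add.commute)
  define S where "S = {z. ((\<lambda>z::complex. z + z\<^sup>2) ^^ N) z \<in> ball 0 \<rho>}"
  obtain B where holo: "B holomorphic_on S" and BA: "\<forall>\<^sub>F z in nhds 0. B z = A z"
    using pullback_extension[OF assms(1,2) fe, of N] unfolding S_def by blast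
  have "continuous_on UNIV ((\<lambda>z::complex. z + z\<^sup>2) ^^ N)"
    by (induction N) (auto intro!: continuous_intros)
  then have "open S"
    unfolding S_def vimage_def[symmetric] by (rule open_vimage[OF open_ball])
  moreover have sub: "cball (- (1/2)) (1/2) \<subseteq> S"
  proof
    fix z :: complex
    assume "z \<in> cball (- (1/2)) (1/2)"
    then have "norm (z + 1/2) \<le> 1/2"
      using norm_minus_commute[of z "- (1/2)"] by (simp add: dist_norm)
    from parabolic_orbit_bound[OF this, of N] N show "z \<in> S"
      by (simp add: S_def)
  qed
  ultimately obtain e where e: "e > 0" "(\<Union>x\<in>cball (- (1/2)) (1/2). cball x e) \<subseteq> S"
    using compact_subset_open_imp_cball_epsilon_subset[of "cball (- (1/2)) (1/2)" S] by auto
  define R where "R = 1/2 + e"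
  define D where "D = (\<lambda>u. B (u - 1/2))"
  have cball: "u - 1/2 \<in> S" if "u \<in> cball 0 R" for u
  proof (cases "norm u \<le> 1/2")
    case True
    then have "u - 1/2 \<in> cball (- (1/2)) (1/2)"
      by (simp add: dist_norm norm_minus_commute)
    then show ?thesis using sub by blast
  next
    case False
    \<comment> \<open>The nearest point of the disc: u is projected radially onto the circle of
      radius 1/2.\<close>
    define x where "x = u / of_real (2 * norm u) - 1/2"
    have "x \<in> cball (- (1/2)) (1/2)"
      using False by (auto simp: x_def dist_norm norm_divide norm_mult)
    moreover have "u - 1/2 \<in> cball x e"
    proof -
      have "x - (u - 1/2) = - (u * of_real (1 - 1 / (2 * norm u)))"
        by (simp add: x_def algebra_simps)
      then have "norm (x - (u - 1/2)) = norm u * \<bar>1 - 1 / (2 * norm u)\<bar>"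
        by (metis norm_minus_cancel norm_mult norm_of_real)
      also have "\<dots> = norm u - 1/2"
        using False by (cases "u = 0") (simp_all add: abs_if field_simps)
      also have "\<dots> \<le> e"
        using that by (simp add: R_def)
      finally show ?thesis by (simp add: dist_norm)
    qed
    ultimately show ?thesis using e by blast
  qed
  have holD: "D holomorphic_on cball 0 R"
    unfolding D_def
    by (rule holomorphic_on_compose_gen[OF _ holo, unfolded o_def])
       (use cball in \<open>auto intro!: holomorphic_intros\<close>)
  have "D (u\<^sup>2 + 1/4) = c * D u - u + 1/2" if u: "(norm u)\<^sup>2 + 1/4 < R" for u :: complex
  proof -
    \<comment> \<open>The condition on u reads |u| < s. As s > 1/2, this disc contains the fixed
      point 1/2, near which the equation comes from the germ of A at 0; the identity theorem spreads
      it.\<close>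
    define s where "s = sqrt (R - 1/4)"
    have "R - 1/4 > 1/4"
      using e by (simp add: R_def)
    then have s: "s > 1/2" "s\<^sup>2 = R - 1/4"
      using real_less_rsqrt[of "1/2" "R - 1/4"] by (auto simp: s_def power2_eq_square)
    have us: "v \<in> ball 0 s \<longleftrightarrow> (norm v)\<^sup>2 + 1/4 < R" for v :: complex
      using s power2_less_imp_less[of "norm v" s] power_strict_mono[of "norm v" s 2] by auto
    have "((\<lambda>z::complex. z + z\<^sup>2) \<longlongrightarrow> 0 + 0\<^sup>2) (nhds 0)"
      by (intro tendsto_intros filterlim_ident)
    then have "\<forall>\<^sub>F z in nhds 0. B (z + z\<^sup>2) = A (z + z\<^sup>2)"
      using eventually_compose_filterlim[OF BA] by simp
    then have "\<forall>\<^sub>F z in nhds 0. B (z + z\<^sup>2) = c * B z - z"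
      using BA fe by eventually_elim simp
    then obtain d where d: "d > 0" "\<And>z. norm z < d \<Longrightarrow> B (z + z\<^sup>2) = c * B z - z"
      unfolding eventually_nhds_metric by auto
    show "D (u\<^sup>2 + 1/4) = c * D u - u + 1/2"
    proof (rule analytic_continuation_open[where s = "ball (1/2) d \<inter> ball 0 s" and s' = "ball 0 s"
          and f = "\<lambda>u. D (u\<^sup>2 + 1/4)" and g = "\<lambda>u. c * D u - u + 1/2"])
      show "ball (1/2) d \<inter> ball 0 s \<noteq> ({} :: complex set)"
        using d(1) s(1) by (auto intro!: exI[of _ "1/2 :: complex"] simp: norm_divide ex_in_conv[symmetric])
      have image: "v\<^sup>2 + 1/4 \<in> cball 0 R" if "v \<in> ball 0 s" for v :: complex
      proof -
        have "norm (v\<^sup>2 + 1/4) < R"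
          using us[of v] that by (intro norm_square_add_quarter_less) blast
        then show ?thesis by simp
      qed
      show "(\<lambda>u. D (u\<^sup>2 + 1/4)) holomorphic_on ball 0 s"
      proof -
        have "(\<lambda>u. u\<^sup>2 + 1/4) holomorphic_on ball (0::complex) s"
          by (intro holomorphic_intros)
        moreover have "(\<lambda>u. u\<^sup>2 + 1/4) ` ball 0 s \<subseteq> cball (0::complex) R"
          using image by blast
        ultimately show ?thesis
          using holomorphic_on_compose_gen[OF _ holD] by (simp add: o_def)
      qed
      have "ball 0 s \<subseteq> cball (0::complex) R"
      proof
        fix v :: complex
        assume "v \<in> ball 0 s"
        then have "norm v < R"
          using us[of v] less_if_square_less[of "norm v" R] by blast
        then show "v \<in> cball 0 R" by simp
      qed
      then show "(\<lambda>u. c * D u - u + 1/2) holomorphic_on ball 0 s"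
        by (intro holomorphic_intros holomorphic_on_subset[OF holD])
      show "D (v\<^sup>2 + 1/4) = c * D v - v + 1/2" if "v \<in> ball (1/2) d \<inter> ball 0 s" for v
      proof -
        have "norm (v - 1/2) < d"
          using that by (simp add: dist_norm norm_minus_commute)
        from d(2)[OF this] show ?thesis
          by (simp add: D_def power2_eq_square algebra_simps)
      qed
    qed (use us u in auto)
  qed
  moreover have "R > 1/2"
    using e by (simp add: R_def)
  moreover have "D holomorphic_on ball 0 R"
    using holD by (rule holomorphic_on_subset) auto
  moreover have "\<forall>\<^sub>F z in nhds 0. D (z + 1/2) = A z"
    using BA by (simp add: D_def)
  ultimately show ?thesis by (intro that)
qed


section \<open>Backward orbits and extension to the slit plane\<close>

text \<open>The roots w of w + w^2 = z are exchanged by w -> -1 - w; the principal square root picks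
  one with Re w >= -1/2, the branch that fixes 0.\<close>

definition parabolic_inv :: "complex \<Rightarrow> complex" where
  "parabolic_inv z = csqrt (z + 1/4) - 1/2"

lemma parabolic_inv_eq: "parabolic_inv z + (parabolic_inv z)\<^sup>2 = z"
proof -
  have "parabolic_inv z + (parabolic_inv z)\<^sup>2 = (csqrt (z + 1/4))\<^sup>2 - 1/4"
    by (simp only: parabolic_inv_def) (simp add: power2_eq_square algebra_simps)
  then show ?thesis by simp
qed

lemma Re_parabolic_inv: "Re (parabolic_inv z) \<ge> - (1/2)"
  using Re_csqrt[of "z + 1/4"] by (simp add: parabolic_inv_def)

lemma parabolic_inv_slit:
  assumes "z \<notin> \<real>\<^sub>\<le>\<^sub>0"
  shows "parabolic_inv z \<notin> \<real>\<^sub>\<le>\<^sub>0"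
proof
  assume nonpos: "parabolic_inv z \<in> \<real>\<^sub>\<le>\<^sub>0"
  define x where "x = Re (parabolic_inv z)"
  have x: "parabolic_inv z = of_real x" "x \<le> 0" "- (1/2) \<le> x"
    using nonpos Re_parabolic_inv[of z] by (auto simp: x_def complex_nonpos_Reals_iff complex_eq_iff)
  have "z = of_real (x * (1 + x))"
    using parabolic_inv_eq[of z] by (simp add: x(1) power2_eq_square algebra_simps)
  moreover have "x * (1 + x) \<le> 0"
    using x by (intro mult_nonpos_nonneg) auto
  ultimately show False
    using assms by (simp add: complex_nonpos_Reals_iff)
qed

lemma holomorphic_parabolic_inv: "parabolic_inv holomorphic_on - \<real>\<^sub>\<le>\<^sub>0"
  unfolding parabolic_inv_def
  by (intro holomorphic_intros) (auto simp: complex_nonpos_Reals_iff)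

text \<open>Keeps backward orbits bounded. L >= 2 is what makes L + 1/4 <= (L - 1/2)^2.\<close>

lemma norm_parabolic_inv_le:
  assumes "norm z \<le> L" "L \<ge> 2"
  shows "norm (parabolic_inv z) \<le> L"
proof -
  have "norm (z + 1/4) \<le> L + 1/4"
    using norm_triangle_ineq[of z "1/4"] assms(1) by (simp add: norm_divide)
  also have "\<dots> \<le> (L - 1/2)\<^sup>2"
    using mult_right_mono[of 2 L L] assms(2) by (simp add: power2_eq_square algebra_simps)
  finally have "sqrt (norm (z + 1/4)) \<le> L - 1/2"
    using assms(2) by (intro real_le_lsqrt) auto
  then show ?thesis
    using norm_triangle_ineq4[of "csqrt (z + 1/4)" "1/2"] by (simp add: parabolic_inv_def norm_divide)
qed

text \<open>With w the inverse image, 1/w = 1/z + 1/(1 + w). Since Re (1 + w) >= 1/2 and |1 + w| <=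
  1 + L, the gain has a lower bound depending on L alone.\<close>

lemma Re_inverse_parabolic_inv:
  assumes "z \<noteq> 0" "norm z \<le> L" "L \<ge> 2"
  shows "Re (1 / parabolic_inv z) \<ge> Re (1 / z) + 1 / (2 * (1 + L)\<^sup>2)"
proof -
  define w where "w = parabolic_inv z"
  have re: "Re (1 + w) \<ge> 1/2"
    using Re_parabolic_inv[of z] by (simp add: w_def)
  then have nz: "1 + w \<noteq> 0"
    by (metis half_gt_zero_iff less_numeral_extra(1) not_le zero_complex.sel(1))
  have z: "z = w * (1 + w)"
    using parabolic_inv_eq[of z] by (simp add: w_def power2_eq_square algebra_simps)
  then have "1 / w = 1 / z + 1 / (1 + w)"
    using nz assms(1) by (simp add: divide_simps)
  moreover have "Re (1 / (1 + w)) \<ge> 1 / (2 * (1 + L)\<^sup>2)"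
  proof -
    have "norm (1 + w) \<le> 1 + L"
      using norm_triangle_ineq[of 1 w] norm_parabolic_inv_le[OF assms(2,3)] by (simp add: w_def)
    then have "(norm (1 + w))\<^sup>2 \<le> (1 + L)\<^sup>2"
      by (intro power_mono) auto
    then have "(1/2) / (1 + L)\<^sup>2 \<le> Re (1 + w) / (norm (1 + w))\<^sup>2"
      using re nz by (intro frac_le) auto
    then show ?thesis
      by (simp add: Re_divide cmod_power2)
  qed
  ultimately show ?thesis by (simp add: w_def)
qed

text \<open>The orbit never leaves the disc of radius L, so every step gains at least the same h and
  the real part grows linearly.\<close>

lemma parabolic_inv_reaches_petal:
  assumes "z \<noteq> 0"
  shows "\<exists>n. Re (1 / (parabolic_inv ^^ n) z) > t"
proof -
  define L where "L = max 2 (norm z)"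
  define h where "h = 1 / (2 * (1 + L)\<^sup>2)"
  have L: "L \<ge> 2" "norm z \<le> L" by (auto simp: L_def)
  then have "h > 0" by (simp add: h_def)
  have orbit: "(parabolic_inv ^^ n) z \<noteq> 0 \<and> norm ((parabolic_inv ^^ n) z) \<le> L \<and>
      Re (1 / (parabolic_inv ^^ n) z) \<ge> Re (1 / z) + real n * h" for n
  proof (induction n)
    case 0
    then show ?case using assms L by simp
  next
    case (Suc n)
    define w where "w = (parabolic_inv ^^ n) z"
    have w: "w \<noteq> 0" "norm w \<le> L" "Re (1 / w) \<ge> Re (1 / z) + real n * h"
      using Suc by (auto simp: w_def)
    have "parabolic_inv w \<noteq> 0"
      using parabolic_inv_eq[of w] w(1) by auto
    moreover have "Re (1 / parabolic_inv w) \<ge> Re (1 / z) + real (Suc n) * h"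
      using Re_inverse_parabolic_inv[OF w(1,2) L(1)] w(3)
      unfolding h_def[symmetric] by (simp add: algebra_simps)
    ultimately show ?case
      using norm_parabolic_inv_le[OF w(2) L(1)] by (simp add: w_def)
  qed
  obtain n where "t - Re (1 / z) < real n * h"
    using reals_Archimedean3[OF \<open>h > 0\<close>] by blast
  then have "Re (1 / (parabolic_inv ^^ n) z) > t"
    using orbit[of n] by linarith
  then show ?thesis ..
qed

text \<open>Read backwards, the equation is A z = c A (g z) - g z with g the inverse branch, so A is
  known at z once it is known at g z. The petal \<open>P\<close> lies in the ball, is mapped into
  itself by g and is reached by every backward orbit, so the sets \<open>W k\<close> increase to the
  whole slit plane.\<close>

lemma slit_extension:
  fixes A :: "complex \<Rightarrow> complex"
  assumes holo: "A holomorphic_on ball 0 \<rho>" and "\<rho> > 0"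
    and fe: "\<And>z. norm z < \<rho> \<Longrightarrow> A (z + z\<^sup>2) = c * A z - z"
  obtains H t where "t > 0" "H holomorphic_on - \<real>\<^sub>\<le>\<^sub>0" "\<And>z. Re (1 / z) > t \<Longrightarrow> H z = A z"
proof -
  define g where "g = parabolic_inv"
  define t where "t = 1 / \<rho>"
  have "t > 0" using \<open>\<rho> > 0\<close> by (simp add: t_def)
  define P where "P = {z::complex. Re (1 / z) > t}"
  have P_norm: "z \<noteq> 0" "norm z < \<rho>" if "z \<in> P" for z
  proof -
    show nz: "z \<noteq> 0" using that \<open>t > 0\<close> by (auto simp: P_def)
    have "1 / \<rho> < norm (1 / z)"
      using that complex_Re_le_cmod[of "1 / z"] by (simp add: P_def t_def)
    then show "norm z < \<rho>"
      using nz \<open>\<rho> > 0\<close> by (simp add: norm_divide field_simps)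
  qed
  have P_g: "g z \<in> P" if "z \<in> P" for z
  proof -
    have "Re (1 / z) + 1 / (2 * (1 + max 2 (norm z))\<^sup>2) \<le> Re (1 / g z)"
      unfolding g_def using P_norm(1)[OF that] by (intro Re_inverse_parabolic_inv) auto
    moreover have "0 \<le> 1 / (2 * (1 + max 2 (norm z))\<^sup>2)" by simp
    ultimately show ?thesis
      using that unfolding P_def mem_Collect_eq by linarith
  qed
  \<comment> \<open>Clearing the denominator makes openness of \<open>P\<close> and Re z > 0 on it
    evident.\<close>
  have P_eq: "P = {z. t * (norm z)\<^sup>2 < Re z}"
  proof -
    have "t < Re (1 / z) \<longleftrightarrow> t * (norm z)\<^sup>2 < Re z" for z
    proof (cases "z = 0")
      case False
      then have "(norm z)\<^sup>2 > 0" by simp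
      moreover have "Re (1 / z) = Re z / (norm z)\<^sup>2"
        by (simp add: Re_divide cmod_power2)
      ultimately show ?thesis by (simp add: pos_less_divide_eq)
    qed (use \<open>t > 0\<close> in auto)
    then show ?thesis by (simp add: P_def)
  qed
  have "open P"
    unfolding P_eq by (intro open_Collect_less continuous_intros)
  define W where "W = (\<lambda>k. {z. z \<notin> \<real>\<^sub>\<le>\<^sub>0 \<and> (g ^^ k) z \<in> P})"
  define A' where "A' = rec_nat A (\<lambda>_ B z. c * B (g z) - g z)"
  have A'_0: "A' 0 = A" and A'_Suc: "A' (Suc k) = (\<lambda>z. c * A' k (g z) - g z)" for k
    by (simp_all add: A'_def)
  have g_slit: "g z \<notin> \<real>\<^sub>\<le>\<^sub>0" if "z \<notin> \<real>\<^sub>\<le>\<^sub>0" for z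
    using parabolic_inv_slit[OF that] by (simp add: g_def)
  have W_Suc: "z \<in> W (Suc k) \<longleftrightarrow> z \<notin> \<real>\<^sub>\<le>\<^sub>0 \<and> g z \<in> W k" for z k
    using g_slit by (auto simp: W_def funpow_swap1)
  have W_mono: "z \<in> W (Suc k)" if "z \<in> W k" for z k
    using that P_g by (auto simp: W_def)
  have g_holo: "g holomorphic_on S" if "S \<subseteq> - \<real>\<^sub>\<le>\<^sub>0" for S
    using holomorphic_parabolic_inv that unfolding g_def by (rule holomorphic_on_subset)
  have "A' k holomorphic_on W k \<and> open (W k)" for k
  proof (induction k)
    case 0
    have "W 0 = P \<inter> - \<real>\<^sub>\<le>\<^sub>0" by (auto simp: W_def)
    moreover have "open (P \<inter> - \<real>\<^sub>\<le>\<^sub>0)"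
      using \<open>open P\<close> by (intro open_Int open_Compl) auto
    moreover have "P \<subseteq> ball 0 \<rho>" using P_norm by auto
    ultimately show ?case
      unfolding A'_0 by (auto intro: holomorphic_on_subset[OF holo])
  next
    case (Suc k)
    have W_eq: "W (Suc k) = - \<real>\<^sub>\<le>\<^sub>0 \<inter> g -` W k"
      using W_Suc by auto
    have "open (W (Suc k))"
      unfolding W_eq
      by (rule continuous_open_preimage) (use Suc g_holo in \<open>auto intro: holomorphic_on_imp_continuous_on\<close>)
    moreover have "A' (Suc k) holomorphic_on W (Suc k)"
    proof -
      have g: "g holomorphic_on W (Suc k)"
        by (rule g_holo) (auto simp: W_eq)
      have "(A' k \<circ> g) holomorphic_on W (Suc k)"
        by (rule holomorphic_on_compose_gen[OF g, of "A' k" "W k"]) (use Suc in \<open>auto simp: W_eq\<close>)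
      then show ?thesis
        unfolding A'_Suc o_def by (intro holomorphic_intros g)
    qed
    ultimately show ?case by blast
  qed
  then have holA': "A' k holomorphic_on W k" and openW: "open (W k)" for k by auto
  have agree: "A' (Suc k) z = A' k z" if "z \<in> W k" for k z
    using that
  proof (induction k arbitrary: z)
    case 0
    then have "norm (g z) < \<rho>"
      by (intro P_norm P_g) (auto simp: W_def)
    from fe[OF this] show ?case
      unfolding A'_Suc A'_0 by (simp add: parabolic_inv_eq g_def)
  next
    case (Suc k)
    then show ?case
      using W_Suc[of z k] by (simp add: A'_Suc)
  qed
  have stable: "A' m z = A' k z" if "z \<in> W k" "m \<ge> k" for m k z
  proof -
    have "z \<in> W m \<and> A' m z = A' k z"
      using that(2) by (induction m rule: dec_induct) (use that(1) W_mono agree in auto)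
    then show ?thesis by blast
  qed
  \<comment> \<open>The least index is an arbitrary choice: by \<open>stable\<close> every k with z
    in \<open>W k\<close> gives the same value.\<close>
  define H where "H = (\<lambda>z. A' (LEAST k. z \<in> W k) z)"
  have H_eq: "H z = A' k z" if "z \<in> W k" for k z
    unfolding H_def by (rule stable[OF LeastI[of "\<lambda>k. z \<in> W k", OF that] Least_le[of "\<lambda>k. z \<in> W k", OF that], symmetric])
  have "H holomorphic_on (\<Union>k\<in>UNIV. W k)"
    using holA' H_eq openW by (intro holomorphic_on_UN_open) (auto cong: holomorphic_cong)
  moreover have "(\<Union>k\<in>UNIV. W k) = - \<real>\<^sub>\<le>\<^sub>0"
  proof (intro set_eqI iffI)
    fix z :: complex
    assume "z \<in> - \<real>\<^sub>\<le>\<^sub>0"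
    then have z: "z \<notin> \<real>\<^sub>\<le>\<^sub>0" "z \<noteq> 0" by auto
    obtain k where "Re (1 / (g ^^ k) z) > t"
      using parabolic_inv_reaches_petal[OF z(2)] unfolding g_def by blast
    then have "z \<in> W k"
      using z(1) unfolding W_def P_def by blast
    then show "z \<in> (\<Union>k\<in>UNIV. W k)" by blast
  qed (auto simp: W_def)
  moreover have "H z = A z" if "Re (1 / z) > t" for z
  proof -
    have "0 \<le> t * (norm z)\<^sup>2" using \<open>t > 0\<close> by simp
    moreover have zP: "z \<in> P" using that by (simp add: P_def)
    ultimately have "Re z > 0" by (simp add: P_eq)
    with zP have "z \<in> W 0"
      by (auto simp: W_def complex_nonpos_Reals_iff)
    from H_eq[OF this] show ?thesis by (simp add: A'_0)
  qed
  ultimately show ?thesis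
    using that[of t H] \<open>t > 0\<close> by simp
qed

section \<open>Gluing and reflection to an entire solution\<close>

lemma entire_extension:
  fixes A :: "complex \<Rightarrow> complex"
  assumes holo: "A holomorphic_on ball 0 \<rho>" and "\<rho> > 0" "c \<noteq> 0"
    and fe: "\<And>z. norm z < \<rho> \<Longrightarrow> A (z + z\<^sup>2) = c * A z - z"
  obtains B where "B holomorphic_on UNIV" "\<And>u. B (u\<^sup>2 + 1/4) = c * B u - u + 1/2"
proof -
  have "\<forall>\<^sub>F z in nhds 0. A (z + z\<^sup>2) = c * A z - z"
    unfolding eventually_nhds_metric using \<open>\<rho> > 0\<close> fe by auto
  then obtain R D where R: "R > 1/2" and holD: "D holomorphic_on ball 0 R"
    and feD: "\<And>u. (norm u)\<^sup>2 + 1/4 < R \<Longrightarrow> D (u\<^sup>2 + 1/4) = c * D u - u + 1/2"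
    and DA: "\<forall>\<^sub>F z in nhds 0. D (z + 1/2) = A z"
    using disc_extension[OF holo \<open>c \<noteq> 0\<close> \<open>\<rho> > 0\<close>] by blast
  obtain H t where t: "t > 0" and holH: "H holomorphic_on - \<real>\<^sub>\<le>\<^sub>0"
    and HA: "\<And>z. Re (1 / z) > t \<Longrightarrow> H z = A z"
    using slit_extension[OF holo \<open>\<rho> > 0\<close> fe] by blast
  define T where "T = {u::complex. u - 1/2 \<notin> \<real>\<^sub>\<le>\<^sub>0}"
  have T_iff: "u \<in> T \<longleftrightarrow> Im u \<noteq> 0 \<or> Re u > 1/2" for u
    by (auto simp: T_def complex_nonpos_Reals_iff)
  have T_nz: "u - 1/2 \<noteq> 0" if "u \<in> T" for u
    using that unfolding T_def by (metis nonpos_Reals_zero_I mem_Collect_eq)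
  have T_eq: "T = (\<lambda>u. u - 1/2) -` (- \<real>\<^sub>\<le>\<^sub>0)"
    by (auto simp: T_def)
  have "open T"
    unfolding T_eq by (rule open_vimage) (auto intro!: continuous_intros)
  define H' where "H' = (\<lambda>u. H (u - 1/2))"
  have holH': "H' holomorphic_on T"
    unfolding H'_def
    by (rule holomorphic_on_compose_gen[OF _ holH, unfolded o_def])
       (auto simp: T_def intro!: holomorphic_intros)
  obtain d where d: "d > 0" "\<And>z. norm z < d \<Longrightarrow> D (z + 1/2) = A z"
    using DA unfolding eventually_nhds_metric by auto
  \<comment> \<open>Chosen so that 1/2 + p lies in the petal, in the disc where D comes from A, and
    in the ball of radius R. The overlap of the two domains is starlike about this point.\<close>
  define p where "p = min (1 / t) (min d (R - 1/2)) / 2"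
  have p: "0 < p" "p < 1 / t" "p < d" "p < R - 1/2"
    using t d(1) R by (auto simp: p_def min_less_iff_disj divide_strict_right_mono)
  define s where "s = {u. t < Re (1 / (u - 1/2))} \<inter> ball (1/2) d \<inter> (ball 0 R \<inter> T)"
  define q where "q = complex_of_real (1/2 + p)"
  have agree: "D u = H' u" if "u \<in> ball 0 R" "u \<in> T" for u
  proof (rule analytic_continuation_open[where s = s and s' = "ball 0 R \<inter> T" and f = D and g = H'])
    have q_ball: "q \<in> ball 0 R" and q_T: "q \<in> T"
      using p by (simp_all add: q_def T_iff del: of_real_add)
    have "t < 1 / p"
      using p t by (simp add: field_simps)
    then have "Re (1 / (q - 1/2)) > t"
      by (simp add: q_def Re_divide_of_real)
    moreover have "q \<in> ball (1/2) d"
      using p by (simp add: q_def dist_norm)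
    ultimately have "q \<in> s"
      using q_ball q_T by (simp add: s_def)
    then show "s \<noteq> {}" by blast
    have "s = (ball (1/2) d \<inter> (ball 0 R \<inter> T)) \<inter> (\<lambda>u. Re (1 / (u - 1/2))) -` {t<..}"
      by (auto simp: s_def)
    also have "open \<dots>"
    proof -
      have "continuous_on (ball (1/2) d \<inter> (ball 0 R \<inter> T)) (\<lambda>u. Re (1 / (u - 1/2)))"
        by (intro continuous_intros) (use T_nz in blast)
      then show ?thesis
        by (rule continuous_open_preimage) (auto intro: \<open>open T\<close>)
    qed
    finally show "open s" .
    show "s \<subseteq> ball 0 R \<inter> T" by (auto simp: s_def)
    show "D v = H' v" if "v \<in> s" for v
      using d(2)[of "v - 1/2"] HA[of "v - 1/2"] that
      by (simp add: s_def H'_def dist_norm norm_minus_commute)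
    show "open (ball 0 R \<inter> T)" using \<open>open T\<close> by auto
    have "closed_segment q v \<subseteq> ball 0 R \<inter> T" if v: "v \<in> ball 0 R \<inter> T" for v
    proof (rule Int_greatest)
      show "closed_segment q v \<subseteq> ball 0 R"
        using v q_ball by (intro closed_segment_subset) auto
      show "closed_segment q v \<subseteq> T"
      proof
        fix w
        assume "w \<in> closed_segment q v"
        then obtain y where y: "0 \<le> y" "y \<le> 1" "w = (1 - y) *\<^sub>R q + y *\<^sub>R v"
          by (auto simp: in_segment)
        show "w \<in> T"
        proof (cases "y = 0 \<or> Im v \<noteq> 0")
          case True
          then show ?thesis
            using y p by (auto simp: T_iff q_def)
        next
          case False
          then have "Re v - 1/2 > 0" "y > 0"
            using v y by (auto simp: T_iff)
          then have "0 < (1 - y) * p + y * (Re v - 1/2)"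
            using y p by (intro add_nonneg_pos) auto
          then show ?thesis
            by (simp add: T_iff y(3) q_def algebra_simps)
        qed
      qed
    qed
    then have "starlike (ball 0 R \<inter> T)"
      unfolding starlike_def using q_ball q_T by blast
    then show "connected (ball 0 R \<inter> T)"
      by (rule starlike_imp_connected)
  qed (use that holD holH' in \<open>auto intro: holomorphic_on_subset\<close>)
  define \<Omega> where "\<Omega> = {u. Im u \<noteq> 0 \<or> Re u > - R}"
  \<comment> \<open>T omits the ray up to 1/2, and the ball restores its part beyond -R.\<close>
  have \<Omega>_eq: "\<Omega> = ball 0 R \<union> T"
  proof (intro set_eqI iffI)
    fix u
    assume u: "u \<in> \<Omega>"
    show "u \<in> ball 0 R \<union> T"
    proof (cases "u \<in> T")
      case False
      then have "Im u = 0" "Re u \<le> 1/2" "Re u > - R"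
        using u by (auto simp: T_iff \<Omega>_def)
      then show ?thesis using R by (simp add: cmod_eq_Re abs_less_iff)
    qed simp
  next
    fix u :: complex
    assume "u \<in> ball 0 R \<union> T"
    then show "u \<in> \<Omega>"
      using abs_Re_le_cmod[of u] R by (auto simp: T_iff \<Omega>_def)
  qed
  have "open \<Omega>"
    unfolding \<Omega>_eq using \<open>open T\<close> by auto
  \<comment> \<open>E is the right-hand side of the equation. Near 0 it equals D (u^2 + 1/4) and so
    is even; this spreads over the intersection of \<Omega> and its mirror image, which is starlike
    about 0.\<close>
  define E where "E = (\<lambda>u. c * (if u \<in> ball 0 R then D u else H' u) - u + 1/2)"
  have holE: "E holomorphic_on \<Omega>"
    unfolding E_def \<Omega>_eq
    by (intro holomorphic_intros holomorphic_on_If_Un holD holH' \<open>open T\<close> agree open_ball)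
  define \<Omega>' where "\<Omega>' = {u. Im u \<noteq> 0 \<or> Re u < R}"
  have \<Omega>'_eq: "\<Omega>' = uminus -` \<Omega>"
    by (auto simp: \<Omega>_def \<Omega>'_def)
  have "open \<Omega>'"
    unfolding \<Omega>'_eq using \<open>open \<Omega>\<close> by (rule open_vimage) (intro continuous_intros)
  have holE': "(\<lambda>u. E (- u)) holomorphic_on \<Omega>'"
    by (rule holomorphic_on_compose_gen[OF _ holE, unfolded o_def])
       (auto simp: \<Omega>'_eq intro!: holomorphic_intros)
  have quarter_R: "open {u::complex. (norm u)\<^sup>2 + 1/4 < R}" "(0::complex) \<in> {u. (norm u)\<^sup>2 + 1/4 < R}"
    using R by (auto intro!: open_Collect_less continuous_intros)
  have sub_ball: "{u::complex. (norm u)\<^sup>2 + 1/4 < R} \<subseteq> ball 0 R"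
    using less_if_square_less by auto
  have E_D: "E u = D (u\<^sup>2 + 1/4)" if "u \<in> {u. (norm u)\<^sup>2 + 1/4 < R}" for u
    using feD[of u] sub_ball that by (auto simp: E_def)
  have even: "E u = E (- u)" if "u \<in> \<Omega>" "u \<in> \<Omega>'" for u
  proof (rule analytic_continuation_open[where s = "{u. (norm u)\<^sup>2 + 1/4 < R}" and s' = "\<Omega> \<inter> \<Omega>'"
        and f = E and g = "\<lambda>u. E (- u)"])
    show "{u::complex. (norm u)\<^sup>2 + 1/4 < R} \<noteq> {}" using quarter_R by blast
    show "{u::complex. (norm u)\<^sup>2 + 1/4 < R} \<subseteq> \<Omega> \<inter> \<Omega>'"
      using sub_ball by (auto simp: \<Omega>_eq \<Omega>'_eq)
    show "E v = E (- v)" if "v \<in> {u. (norm u)\<^sup>2 + 1/4 < R}" for v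
      using E_D[of v] E_D[of "- v"] that by simp
    have "closed_segment 0 v \<subseteq> \<Omega> \<inter> \<Omega>'" if v: "v \<in> \<Omega> \<inter> \<Omega>'" for v
    proof
      fix w
      assume "w \<in> closed_segment 0 v"
      then obtain y where y: "0 \<le> y" "y \<le> 1" "w = y *\<^sub>R v"
        by (auto simp: in_segment)
      have "\<bar>y * Re v\<bar> \<le> \<bar>Re v\<bar>"
        using y by (simp add: abs_mult mult_left_le_one_le)
      then show "w \<in> \<Omega> \<inter> \<Omega>'"
        using v y R by (cases "y = 0") (auto simp: \<Omega>_def \<Omega>'_def)
    qed
    moreover have "0 \<in> \<Omega> \<inter> \<Omega>'"
      using R by (simp add: \<Omega>_def \<Omega>'_def)
    ultimately have "starlike (\<Omega> \<inter> \<Omega>')"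
      unfolding starlike_def by blast
    then show "connected (\<Omega> \<inter> \<Omega>')"
      by (rule starlike_imp_connected)
  qed (use that quarter_R holE holE' \<open>open \<Omega>\<close> \<open>open \<Omega>'\<close> in \<open>auto intro: holomorphic_on_subset\<close>)
  \<comment> \<open>The definition of E solved for the solution, with E continued by evenness across
    the missing ray.\<close>
  define B where "B = (\<lambda>u. ((if u \<in> \<Omega> then E u else E (- u)) + u - 1/2) / c)"
  have "\<Omega> \<union> \<Omega>' = UNIV"
    using R by (auto simp: \<Omega>_def \<Omega>'_def)
  moreover have "(\<lambda>u. if u \<in> \<Omega> then E u else E (- u)) holomorphic_on \<Omega> \<union> \<Omega>'"
    by (intro holomorphic_on_If_Un holE holE' even \<open>open \<Omega>\<close> \<open>open \<Omega>'\<close>)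
  ultimately have holB: "B holomorphic_on UNIV"
    unfolding B_def using \<open>c \<noteq> 0\<close> by (intro holomorphic_intros) auto
  have B_D: "B u = D u" if "u \<in> ball 0 R" for u
    using that \<open>c \<noteq> 0\<close> by (simp add: B_def E_def \<Omega>_eq)
  have "B (u\<^sup>2 + 1/4) = c * B u - u + 1/2" for u
  proof (rule analytic_continuation_open[where s = "{u. (norm u)\<^sup>2 + 1/4 < R}" and s' = UNIV
        and f = "\<lambda>u. B (u\<^sup>2 + 1/4)" and g = "\<lambda>u. c * B u - u + 1/2"])
    show "{u::complex. (norm u)\<^sup>2 + 1/4 < R} \<noteq> {}" using quarter_R by blast
    show "(\<lambda>u. B (u\<^sup>2 + 1/4)) holomorphic_on UNIV"
      by (rule holomorphic_on_compose_gen[OF _ holB, unfolded o_def]) (auto intro!: holomorphic_intros)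
    show "(\<lambda>u. c * B u - u + 1/2) holomorphic_on UNIV"
      by (intro holomorphic_intros holB)
    show "B (v\<^sup>2 + 1/4) = c * B v - v + 1/2" if v: "v \<in> {u. (norm u)\<^sup>2 + 1/4 < R}" for v
      using v sub_ball feD[of v] norm_square_add_quarter_less[of v R] by (auto simp: B_D)
  qed (use quarter_R in auto)
  then show ?thesis
    using that holB by blast
qed

section \<open>Growth of an entire solution\<close>

text \<open>0 is the critical point of u^2 + 1/4, so the left side of the equation has derivative 0
  there.\<close>

lemma entire_solution_deriv:
  assumes holo: "B holomorphic_on UNIV" and fe: "\<And>u. B (u\<^sup>2 + 1/4) = c * B u - u + 1/2"
  shows "c * deriv B 0 = 1"
proof -
  have D: "(B has_field_derivative deriv B w) (at w)" for w
    using holomorphic_derivI[OF holo] by simp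
  have "((\<lambda>u. B (u\<^sup>2 + 1/4)) has_field_derivative deriv B (0\<^sup>2 + 1/4) * (2 * 0)) (at 0)"
    by (rule DERIV_chain2[OF D]) (auto intro!: derivative_eq_intros)
  moreover have "((\<lambda>u. c * B u - u + 1/2) has_field_derivative c * deriv B 0 - 1) (at 0)"
    using D[of 0] by (auto intro!: derivative_eq_intros)
  ultimately have "deriv B (0\<^sup>2 + 1/4) * (2 * 0) = c * deriv B 0 - 1"
    unfolding fe by (rule DERIV_unique)
  then show ?thesis by simp
qed

text \<open>Cauchy's inequality on the circle of radius R/2, since the bound holds on the open ball
  only; hence the factor 2.\<close>

lemma deriv_bound:
  fixes B :: "complex \<Rightarrow> complex"
  assumes "B holomorphic_on ball 0 R" "R > 0" and M: "\<And>u. u \<in> ball 0 R \<Longrightarrow> norm (B u) \<le> M"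
  shows "norm (deriv B 0) \<le> 2 * M / R"
proof -
  have sub: "cball 0 (R/2) \<subseteq> ball (0::complex) R"
    using assms(2) by auto
  have "norm ((deriv ^^ 1) B 0) \<le> fact 1 * M / (R/2) ^ 1"
  proof (rule Cauchy_inequality)
    show "B holomorphic_on ball 0 (R/2)"
      using assms(1) by (rule holomorphic_on_subset) (use assms(2) in auto)
    show "continuous_on (cball 0 (R/2)) B"
      using assms(1) sub by (meson holomorphic_on_imp_continuous_on holomorphic_on_subset)
    show "norm (B x) \<le> M" if "norm (0 - x) = R/2" for x
      using M[of x] that assms(2) by simp
  qed (use assms(2) in auto)
  then show ?thesis by (simp add: mult.commute)
qed


text \<open>A bound M on radius R yields |c| M + R + 1/2 on radius R^2 - 1/4. For large R this at
  least halves M/R up to a small error, so M/R drops below the lower bound that the derivative at 0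
  imposes.\<close>

lemma no_entire_solution:
  assumes holo: "B holomorphic_on UNIV" and fe: "\<And>u. B (u\<^sup>2 + 1/4) = c * B u - u + 1/2"
  shows False
proof -
  define bd where "bd = (\<lambda>R M. \<forall>u\<in>ball 0 R. norm (B u) \<le> M)"
  have step: "bd (R\<^sup>2 - 1/4) (norm c * M + R + 1/2)" if "bd R M" "R > 0" for R M
    unfolding bd_def
  proof
    fix w :: complex
    assume w: "w \<in> ball 0 (R\<^sup>2 - 1/4)"
    define u where "u = csqrt (w - 1/4)"
    have "norm (u\<^sup>2) < R\<^sup>2"
      using w norm_triangle_ineq4[of w "1/4"] by (simp add: u_def norm_divide)
    then have u: "norm u < R"
      using \<open>R > 0\<close> power2_less_imp_less[of "norm u" R] by (simp add: norm_power)
    have "B w = c * B u - u + 1/2"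
      using fe[of u] by (simp add: u_def)
    also have "norm \<dots> \<le> norm (c * B u) + norm u + norm (1/2 :: complex)"
      using norm_triangle_ineq[of "c * B u - u" "1/2"] norm_triangle_ineq4[of "c * B u" u] by linarith
    also have "\<dots> \<le> norm c * M + R + 1/2"
      using u that(1) by (intro add_mono) (auto simp: bd_def norm_mult norm_divide intro!: mult_left_mono)
    finally show "norm (B w) \<le> norm c * M + R + 1/2" .
  qed
  have M_nonneg: "M \<ge> 0" if "bd R M" "R > 0" for R M
  proof -
    have "norm (B 0) \<le> M" using that by (simp add: bd_def)
    then show ?thesis using norm_ge_zero order_trans by blast
  qed
  have lower: "1 \<le> 2 * norm c * (M / R)" if "bd R M" "R > 0" for R M
  proof -
    have "1 = norm c * norm (deriv B 0)"
      using entire_solution_deriv[OF holo fe] by (metis norm_mult norm_one)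
    also have "\<dots> \<le> norm c * (2 * M / R)"
      using that holo by (intro mult_left_mono deriv_bound) (auto simp: bd_def intro: holomorphic_on_subset)
    finally show ?thesis by (simp add: mult_ac)
  qed
  \<comment> \<open>T >= 4 |c| gives the contraction factor 2 |c| / R <= 1/2, T >= 2 keeps the radii
    above T, and T > 18 |c| gives the final contradiction.\<close>
  define T where "T = 20 * norm c + 2"
  have T: "T \<ge> 2" "T \<ge> 4 * norm c" "T > 0"
    using norm_ge_zero[of c] unfolding T_def by linarith+
  have "compact (B ` cball 0 T)"
    using holo by (intro compact_continuous_image holomorphic_on_imp_continuous_on)
      (auto intro: holomorphic_on_subset)
  then have "bounded (B ` cball 0 T)"
    by (rule compact_imp_bounded)
  then obtain M0 where "\<forall>w\<in>B ` cball 0 T. norm w \<le> M0"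
    unfolding bounded_iff by blast
  then have M0: "norm (B u) \<le> M0" if "norm u \<le> T" for u
    using that by simp
  define q where "q = M0 / T"
  \<comment> \<open>8/T is the fixed point of y -> y/2 + 4/T.\<close>
  have reach: "\<exists>R M. bd R M \<and> R \<ge> T \<and> M / R \<le> q / 2 ^ k + 8 / T" for k
  proof (induction k)
    case 0
    have "bd T M0" using M0 by (simp add: bd_def)
    moreover have "M0 / T \<le> q / 2 ^ 0 + 8 / T"
      using T by (simp add: q_def)
    ultimately show ?case by blast
  next
    case (Suc k)
    then obtain R M where *: "bd R M" "R \<ge> T" "M / R \<le> q / 2 ^ k + 8 / T" by blast
    have R: "R \<ge> 2" "R \<ge> 4 * norm c" "R > 0"
      using *(2) T by linarith+
    have "2 * R \<le> R * R"
      using R by (intro mult_right_mono) auto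
    then have ge: "R\<^sup>2 - 1/4 \<ge> R\<^sup>2 / 2" "R\<^sup>2 - 1/4 \<ge> T"
      using R *(2) unfolding power2_eq_square by linarith+
    have "norm c * M + R + 1/2 \<le> norm c * M + 2 * R"
      using R by simp
    then have "(norm c * M + R + 1/2) / (R\<^sup>2 - 1/4) \<le> (norm c * M + 2 * R) / (R\<^sup>2 / 2)"
      using ge R M_nonneg[OF *(1)] by (intro frac_le) auto
    also have "\<dots> = (2 * norm c / R) * (M / R) + 4 / R"
      using R by (simp add: field_simps power2_eq_square)
    also have "\<dots> \<le> 1/2 * (M / R) + 4 / T"
      using R *(2) M_nonneg[OF *(1)] T
      by (intro add_mono mult_right_mono divide_left_mono) (auto simp: field_simps)
    also have "\<dots> \<le> 1/2 * (q / 2 ^ k + 8 / T) + 4 / T"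
      using *(3) by simp
    also have "\<dots> = q / 2 ^ Suc k + 8 / T"
      by (simp add: add_divide_distrib)
    finally show ?case
      using step[OF *(1) R(3)] ge(2) by blast
  qed
  obtain k where "q * T < 2 ^ k"
    using real_arch_pow[of 2 "q * T"] by auto
  then have "q / 2 ^ k < 1 / T"
    using T by (simp add: field_simps)
  moreover obtain R M where 2: "bd R M" "R \<ge> T" "M / R \<le> q / 2 ^ k + 8 / T"
    using reach by blast
  ultimately have "M / R \<le> 9 / T" by simp
  then have "2 * norm c * (M / R) \<le> 2 * norm c * (9 / T)"
    by (intro mult_left_mono) auto
  also have "\<dots> < 1"
    using norm_ge_zero[of c] T by (simp add: T_def divide_less_eq add_nonneg_pos)
  finally show False
    using lower[OF 2(1)] 2(2) T by simp
qed

section \<open>The generating function\<close>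

text \<open>X + X^2 = X (1 + X), so this is the coefficient of X^(n - i) in (1 + X)^i. It turns the
  sum of the recurrence into a composition.\<close>

lemma fps_X_add_X2_power_nth:
  "fps_nth ((fps_X + fps_X\<^sup>2 :: 'a::comm_ring_1 fps) ^ i) n = (if i \<le> n then of_nat (i choose (n - i)) else 0)"
proof -
  have "(fps_X + fps_X\<^sup>2 :: 'a fps) ^ i = fps_X ^ i * (1 + fps_X) ^ i"
    by (simp add: power2_eq_square algebra_simps flip: power_mult_distrib)
  moreover have "(1 + fps_X :: 'a fps) ^ i = (\<Sum>k\<le>i. of_nat (i choose k) * fps_X ^ k)"
    using binomial_ring[of "fps_X :: 'a fps" 1 i] by (simp add: add.commute)
  moreover have "fps_nth (\<Sum>k\<le>i. of_nat (i choose k) * fps_X ^ k :: 'a fps) m = of_nat (i choose m)" for m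
  proof -
    have "fps_nth (\<Sum>k\<le>i. of_nat (i choose k) * fps_X ^ k :: 'a fps) m
        = (\<Sum>k\<le>i. if k = m then of_nat (i choose k) else 0)"
      unfolding fps_sum_nth by (intro sum.cong) (auto simp: fps_of_nat[symmetric])
    then show ?thesis by (auto simp: binomial_eq_0)
  qed
  ultimately show ?thesis
    by (auto simp: fps_X_power_mult_nth)
qed

theorem theorem1:
  fixes x :: real and a :: "nat \<Rightarrow> real"
  assumes "x \<noteq> -1" and "x \<noteq> 0"
    and "a 1 = x"
    and "\<And>n. n \<ge> 2 \<Longrightarrow>
           a n = x * (\<Sum>r = nat \<lceil>real n / 2\<rceil>..n - 1. real (r choose (n - r)) * a r)"
  shows "\<forall>C::real. C > 0 \<longrightarrow> limsup (\<lambda>n. ereal (\<bar>a n\<bar> / C ^ n)) = \<infinity>"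
proof (intro allI impI, rule ccontr)
  fix C :: real
  assume C: "C > 0" and "limsup (\<lambda>n. ereal (\<bar>a n\<bar> / C ^ n)) \<noteq> \<infinity>"
  then have "limsup (\<lambda>n. ereal (\<bar>a n\<bar> / C ^ n)) < \<infinity>" by simp
  then obtain K :: nat where "limsup (\<lambda>n. ereal (\<bar>a n\<bar> / C ^ n)) < ereal (real K)"
    using less_PInf_Ex_of_nat by auto
  then have ev: "\<forall>\<^sub>F n in sequentially. \<bar>a n\<bar> / C ^ n < real K"
    by (auto dest: Limsup_lessD)
  \<comment> \<open>The hypotheses do not fix \<open>a 0\<close>; constant term 0 lets the composed
    sums start at r = 1.\<close>
  define F where "F = Abs_fps (\<lambda>n. if n = 0 then 0 else complex_of_real (a n))"
  have F_nth: "fps_nth F n = (if n = 0 then 0 else complex_of_real (a n))" for n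
    by (simp add: F_def)
  \<comment> \<open>Half of 1/C: the bound |a n| < K C^n then becomes a geometric series of ratio
    1/2.\<close>
  have "summable (\<lambda>n. fps_nth F n * (of_real (1 / (2 * C))) ^ n)"
  proof (rule summable_comparison_test_ev)
    show "summable (\<lambda>n. real K * (1/2) ^ n)"
      by (intro summable_mult summable_geometric) simp
    show "\<forall>\<^sub>F n in sequentially. norm (fps_nth F n * (of_real (1 / (2 * C))) ^ n) \<le> real K * (1/2) ^ n"
      using ev
    proof eventually_elim
      case (elim n)
      have "norm (fps_nth F n * (of_real (1 / (2 * C))) ^ n) \<le> \<bar>a n\<bar> * (1 / (2 * C)) ^ n"
        using C by (simp add: F_nth norm_mult norm_power norm_divide)
      also have "\<dots> = \<bar>a n\<bar> / C ^ n * (1/2) ^ n"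
        by (simp add: power_divide power_mult_distrib)
      also have "\<dots> \<le> real K * (1/2) ^ n"
        using elim by (intro mult_right_mono) auto
      finally show ?case .
    qed
  qed
  then have "ereal (norm (of_real (1 / (2 * C)) :: complex)) \<le> fps_conv_radius F"
    unfolding fps_conv_radius_def by (rule conv_radius_geI)
  then have rad: "ereal (1 / (2 * C)) \<le> fps_conv_radius F"
    using C by (simp add: norm_divide norm_mult)
  define \<rho> where "\<rho> = 1 / (2 * C)"
  have "\<rho> > 0" using C by (simp add: \<rho>_def)
  have radpos: "fps_conv_radius F > 0"
    using rad \<open>\<rho> > 0\<close> unfolding \<rho>_def[symmetric] by (metis ereal_less(2) order_less_le_trans)
  define A where "A = eval_fps F"
  have "ball 0 \<rho> \<subseteq> eball (0::complex) (fps_conv_radius F)"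
    using rad by (auto simp: \<rho>_def in_eball_iff intro!: less_le_trans[OF _ rad])
  then have holo: "A holomorphic_on ball 0 \<rho>"
    unfolding A_def by (rule holomorphic_on_eval_fps)
  have A: "A has_fps_expansion F"
    using radpos by (simp add: has_fps_expansion_def A_def)
  define c where "c = complex_of_real ((1 + x) / x)"
  have "c \<noteq> 0"
    unfolding c_def of_real_eq_0_iff using assms(1,2) by simp
  \<comment> \<open>For n >= 2 the recurrence lacks only the term r = n, which contributes x a_n and
    makes the factor 1 + x. The term -X corrects n = 1, where c x - 1 = x.\<close>
  have "fps_nth (F oo (fps_X + fps_X\<^sup>2)) n = fps_nth (fps_const c * F - fps_X) n" for n
  proof -
    have coeff: "fps_nth (F oo (fps_X + fps_X\<^sup>2)) n = of_real (\<Sum>r=1..n. real (r choose (n - r)) * a r)"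
      by (auto simp: fps_compose_nth fps_X_add_X2_power_nth F_nth mult.commute intro!: sum.mono_neutral_cong_right)
    have eq: "x * (\<Sum>r=1..n. real (r choose (n - r)) * a r) = (1 + x) * a n" if "n \<ge> 2"
    proof -
      have "(\<Sum>r=1..n-1. real (r choose (n - r)) * a r)
          = (\<Sum>r = nat \<lceil>real n / 2\<rceil>..n - 1. real (r choose (n - r)) * a r)"
      proof (rule sum.mono_neutral_right)
        show "\<forall>r\<in>{1..n - 1} - {nat \<lceil>real n / 2\<rceil>..n - 1}. real (r choose (n - r)) * a r = 0"
        proof
          fix r
          assume "r \<in> {1..n - 1} - {nat \<lceil>real n / 2\<rceil>..n - 1}"
          then have "r < n - r" by (auto; linarith)
          then show "real (r choose (n - r)) * a r = 0"
            by (simp add: binomial_eq_0)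
        qed
        show "{nat \<lceil>real n / 2\<rceil>..n - 1} \<subseteq> {1..n - 1}"
          using that by (auto simp: Suc_le_eq)
      qed simp
      moreover have "{1..n} = insert n {1..n-1}"
        using that by auto
      ultimately show ?thesis
        using assms(4)[OF that] that by (simp add: algebra_simps)
    qed
    consider "n = 0" | "n = 1" | "n \<ge> 2" by linarith
    then show ?thesis
    proof cases
      case 3
      then have "(\<Sum>r=1..n. real (r choose (n - r)) * a r) = (1 + x) / x * a n"
        using eq assms(2) by (simp add: field_simps)
      then have "fps_nth (F oo (fps_X + fps_X\<^sup>2)) n = c * of_real (a n)"
        unfolding coeff c_def of_real_mult[symmetric] by (rule arg_cong)
      then show ?thesis
        using 3 by (simp add: F_nth)
    qed (unfold coeff, use assms(2,3) in \<open>simp_all add: F_nth c_def field_simps\<close>)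
  qed
  then have comp: "F oo (fps_X + fps_X\<^sup>2) = fps_const c * F - fps_X"
    by (simp add: fps_eq_iff)
  have "(\<lambda>z. z + z\<^sup>2) has_fps_expansion (fps_X + fps_X\<^sup>2 :: complex fps)"
    by (intro fps_expansion_intros)
  then have "(A \<circ> (\<lambda>z. z + z\<^sup>2)) has_fps_expansion (fps_const c * F - fps_X)"
    unfolding comp[symmetric] by (intro has_fps_expansion_compose A) auto
  moreover have "(\<lambda>z. c * A z - z) has_fps_expansion (fps_const c * F - fps_X)"
    by (intro fps_expansion_intros A)
  ultimately have
      "\<forall>\<^sub>F z in nhds 0. eval_fps (fps_const c * F - fps_X) z = A (z + z\<^sup>2)"
      "\<forall>\<^sub>F z in nhds 0. eval_fps (fps_const c * F - fps_X) z = c * A z - z"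
    unfolding has_fps_expansion_def o_def by auto
  then have "\<forall>\<^sub>F z in nhds 0. A (z + z\<^sup>2) = c * A z - z"
    by eventually_elim simp
  then obtain \<delta> where "\<delta> > 0" "\<And>z. norm z < \<delta> \<Longrightarrow> A (z + z\<^sup>2) = c * A z - z"
    unfolding eventually_nhds_metric by auto
  \<comment> \<open>The radius is shrunk so that the equation holds on the whole ball.\<close>
  moreover have "A holomorphic_on ball 0 (min \<rho> \<delta>)"
    using holo by (rule holomorphic_on_subset) auto
  ultimately obtain B where "B holomorphic_on UNIV" "\<And>u. B (u\<^sup>2 + 1/4) = c * B u - u + 1/2"
    using entire_extension[of A "min \<rho> \<delta>" c] \<open>\<rho> > 0\<close> \<open>c \<noteq> 0\<close>
    by (metis min_less_iff_conj)
  then show False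
    by (rule no_entire_solution)
qed

end
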